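(* (Isogonal Property) Let $D=V_1V_2\cdots V_n$ be a discrete conic with foci $F,F'$ and sides $S_i=V_iV_{i+1}$, and let $M_i$ be the point of tangency of $S_i$ with the inscribed conic $C_L$. If $Z$ is a point lying on the intersection of two sides $S_i$ and $S_j$ of $D$, then $FZ$ bisects the angles $\angle M_iFM_j$, $\angle V_iFV_{j+1}$ and $\angle V_{i+1}FV_j$. Moreover, $FZ$ and $F'Z$ are isogonal with respect to $S_i$ and $S_j$.
   Context: Let $C$ be a conic with focus $F$. A discrete conic (on $C$) is a polygon $V_1V_2\cdots V_n$ with vertices on $C$ such that, for some fixed $\theta\in\mathbb{R}$, $\angle V_iFV_{i+1}=\theta$ for every $i\in\{1,2,\ldots,n\}$. When $C$ is a hyperbola, a parabola or a degenerate conic, the rays used in measuring an angle are allowed to wrap around the plane. The sides $S_i=V_iV_{i+1}$ of a discrete conic are tangent to a conic with focus $F$, denoted $C_L$, and $M_i=V_iV_{i+1}\cap C_L$ is the point of tangency. Let $F'$ be the other focus of $C_L$; $F$ and $F'$ are called the foci of the discrete conic. Two lines through $Z$ are isogonal with respect to two lines $S_i,S_j$ through $Z$ if they are mirror images of each other in a bisector of the angle formed by $S_i$ and $S_j$. *)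

theory Defs
  imports "HOL-Analysis.Analysis"
begin

text \<open>The Euclidean plane is \<^typ>\<open>complex\<close>. The second focus of a parabola and the point of contact
  of an asymptote of a hyperbola lie at infinity: \<open>Ideal d\<close> is the common point at infinity of the
  lines with direction \<open>d \<noteq> 0\<close>.\<close>

datatype xpoint = Proper complex | Ideal complex

fun line_to :: "complex \<Rightarrow> xpoint \<Rightarrow> complex set" where
  "line_to Z (Proper P) = affine hull {Z, P}"
| "line_to Z (Ideal d) = affine hull {Z, Z + d}"

text \<open>A conic with a distinguished focus \<open>F\<close>, given by its polar equation
  \<open>r * (coef_r + coef_x \<bullet> u) = coef_0\<close> for the points \<open>F + r * u\<close> with \<open>norm u = 1\<close> and a signed
  radius \<open>r\<close>; with \<open>coef_r = 1\<close> and \<open>coef_x = e * cis \<omega>\<close> this is \<open>r = coef_0 / (1 + e * cos (\<phi> - \<omega>))\<close>.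
  The eccentricity is \<open>norm coef_x / coef_r\<close>. The degenerate conics are the lines
  (\<open>coef_r = 0\<close>) and the conics consisting of lines through \<open>F\<close> or of \<open>F\<close> only (\<open>coef_0 = 0\<close>).\<close>

record focal_conic =
  focus :: complex
  coef_r :: real
  coef_x :: complex
  coef_0 :: real

text \<open>The signs are a normalisation only: negating all three coefficients changes nothing, and
  negating \<open>coef_r\<close> alone amounts to replacing \<open>(r, u)\<close> by \<open>(-r, -u)\<close>.\<close>

definition conic :: "focal_conic \<Rightarrow> bool" where
  "conic K \<longleftrightarrow> coef_r K \<ge> 0 \<and> coef_0 K \<ge> 0 \<and> (coef_r K \<noteq> 0 \<or> coef_x K \<noteq> 0)"

definition nondegenerate_conic :: "focal_conic \<Rightarrow> bool" where
  "nondegenerate_conic K \<longleftrightarrow> coef_r K > 0 \<and> coef_0 K > 0"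

definition conic_points :: "focal_conic \<Rightarrow> complex set" where
  "conic_points K = {X. \<exists>u r. norm u = 1 \<and> X = focus K + of_real r * u \<and>
                             r * (coef_r K + coef_x K \<bullet> u) = coef_0 K}"

lemma conic_points_focus_directrix:
  assumes "conic K"
  shows "conic_points K =
    {X. coef_r K * dist X (focus K) = \<bar>coef_0 K - coef_x K \<bullet> (X - focus K)\<bar>}"
proof (intro set_eqI iffI)
  fix X assume "X \<in> conic_points K"
  then obtain u r where u: "norm u = 1" and X: "X = focus K + of_real r * u"
    and eq: "r * (coef_r K + coef_x K \<bullet> u) = coef_0 K"
    by (auto simp: conic_points_def)
  have "coef_0 K - coef_x K \<bullet> (X - focus K) = coef_r K * r"
    unfolding X eq[symmetric] scaleR_conv_of_real[symmetric] by (simp add: algebra_simps)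
  moreover have "dist X (focus K) = \<bar>r\<bar>"
    using X u by (simp add: dist_norm norm_mult)
  ultimately show "X \<in> {X. coef_r K * dist X (focus K) = \<bar>coef_0 K - coef_x K \<bullet> (X - focus K)\<bar>}"
    using assms by (simp add: conic_def abs_mult)
next
  fix X assume "X \<in> {X. coef_r K * dist X (focus K) = \<bar>coef_0 K - coef_x K \<bullet> (X - focus K)\<bar>}"
  then have eq: "coef_r K * norm (X - focus K) = \<bar>coef_0 K - coef_x K \<bullet> (X - focus K)\<bar>"
    by (simp add: dist_norm)
  have "\<exists>r. \<bar>r\<bar> = norm (X - focus K) \<and> coef_r K * r = coef_0 K - coef_x K \<bullet> (X - focus K)"
  proof (cases "coef_0 K - coef_x K \<bullet> (X - focus K) \<ge> 0")
    case True then show ?thesis using eq by (intro exI[of _ "norm (X - focus K)"]) simp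
  next
    case False then show ?thesis using eq by (intro exI[of _ "- norm (X - focus K)"]) simp
  qed
  then obtain r where r: "\<bar>r\<bar> = norm (X - focus K)"
    and req: "coef_r K * r = coef_0 K - coef_x K \<bullet> (X - focus K)" by blast
  define u where "u = (if r = 0 then 1 else (X - focus K) / of_real r)"
  have u: "norm u = 1"
    using r by (auto simp: u_def norm_divide)
  have Xu: "X - focus K = r *\<^sub>R u"
    using r by (auto simp: u_def scaleR_conv_of_real)
  have "r * (coef_r K + coef_x K \<bullet> u) = coef_0 K"
    using req unfolding Xu by (simp add: algebra_simps)
  moreover have "X = focus K + of_real r * u"
    using Xu by (simp add: scaleR_conv_of_real algebra_simps)
  ultimately show "X \<in> conic_points K"
    using u unfolding conic_points_def by blast
qed

text \<open>\<open>on_ray K u P\<close>: the ray from the focus with direction \<open>u\<close>, continued through infinity and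
  back along the opposite ray, meets \<open>K\<close> at \<open>P\<close>. A negative \<open>r\<close> means that the ray has wrapped around
  the plane; for an ellipse and a parabola \<open>r\<close> is always positive, and for a hyperbola \<open>r\<close> is negative
  exactly on the branch remote from the focus. For a line both signs of \<open>r\<close> occur at every point.\<close>

fun on_ray :: "focal_conic \<Rightarrow> complex \<Rightarrow> xpoint \<Rightarrow> bool" where
  "on_ray K u (Proper X) \<longleftrightarrow>
     norm u = 1 \<and> (\<exists>r. r \<noteq> 0 \<and> X = focus K + of_real r * u \<and>
                      r * (coef_r K + coef_x K \<bullet> u) = coef_0 K)"
| "on_ray K u (Ideal d) \<longleftrightarrow>
     norm u = 1 \<and> coef_r K + coef_x K \<bullet> u = 0 \<and> (\<exists>c. c \<noteq> 0 \<and> d = of_real c * u)"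

definition ray_angle :: "focal_conic \<Rightarrow> complex \<Rightarrow> complex \<Rightarrow> real \<Rightarrow> bool" where
  "ray_angle K X Y \<theta> \<longleftrightarrow> (\<exists>u. on_ray K u (Proper X) \<and> on_ray K (cis \<theta> * u) (Proper Y))"

definition discrete_conic :: "focal_conic \<Rightarrow> nat \<Rightarrow> (nat \<Rightarrow> complex) \<Rightarrow> bool" where
  "discrete_conic C n V \<longleftrightarrow>
     conic C \<and> n \<ge> 3 \<and> V (n + 1) = V 1 \<and>
     (\<forall>k\<in>{1..n}. V k \<in> conic_points C \<and> V k \<noteq> V (k + 1)) \<and>
     (\<exists>\<theta>. \<forall>k\<in>{1..n}. ray_angle C (V k) (V (k + 1)) \<theta>)"

definition side :: "(nat \<Rightarrow> complex) \<Rightarrow> nat \<Rightarrow> complex set" where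
  "side V k = affine hull {V k, V (k + 1)}"

fun other_focus :: "focal_conic \<Rightarrow> xpoint \<Rightarrow> bool" where
  "other_focus K (Proper G) \<longleftrightarrow>
     (\<exists>s. s > dist (focus K) G \<and>
          conic_points K = {X. dist X (focus K) + dist X G = s}) \<or>
     (\<exists>s. 0 < s \<and> s < dist (focus K) G \<and>
          conic_points K = {X. \<bar>dist X (focus K) - dist X G\<bar> = s})"
| "other_focus K (Ideal d) \<longleftrightarrow>
     d \<noteq> 0 \<and>
     (\<exists>c. c \<noteq> 0 \<and>
          conic_points K = {X. dist X (focus K) = infdist X {Y. d \<bullet> (Y - focus K) = c}})"

text \<open>The Cartesian equation of \<open>K\<close> is \<open>conic_form K X = 0\<close>. A line is tangent at \<open>P\<close> if it meets
  \<open>K\<close> in the double point \<open>P\<close>: along the line the form is a multiple of the square of the parameter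
  centred at \<open>P\<close>, or a nonzero constant if \<open>P\<close> is at infinity, i.e. if the line is an asymptote.\<close>

definition conic_form :: "focal_conic \<Rightarrow> complex \<Rightarrow> real" where
  "conic_form K X = (coef_r K * norm (X - focus K))\<^sup>2 - (coef_0 K - coef_x K \<bullet> (X - focus K))\<^sup>2"

fun tangent_at :: "focal_conic \<Rightarrow> complex set \<Rightarrow> xpoint \<Rightarrow> bool" where
  "tangent_at K L (Proper P) \<longleftrightarrow>
     (\<exists>d k. d \<noteq> 0 \<and> k \<noteq> 0 \<and> L = affine hull {P, P + d} \<and>
            (\<forall>t. conic_form K (P + of_real t * d) = k * t\<^sup>2))"
| "tangent_at K L (Ideal d) \<longleftrightarrow>
     d \<noteq> 0 \<and> (\<exists>A k. k \<noteq> 0 \<and> L = affine hull {A, A + d} \<and>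
                   (\<forall>t. conic_form K (A + of_real t * d) = k))"

lemma conic_form_eq_0_iff:
  assumes "conic K"
  shows "conic_form K X = 0 \<longleftrightarrow> X \<in> conic_points K"
proof -
  have "coef_r K * norm (X - focus K) \<ge> 0"
    using assms by (simp add: conic_def)
  then show ?thesis
    unfolding conic_points_focus_directrix[OF assms] conic_form_def dist_norm mem_Collect_eq
      right_minus_eq power2_eq_iff by linarith
qed

text \<open>Reflection in the line through \<open>Z\<close> with direction \<open>w \<noteq> 0\<close>.\<close>

definition mirror :: "complex \<Rightarrow> complex \<Rightarrow> complex \<Rightarrow> complex" where
  "mirror Z w X = Z + w * cnj ((X - Z) / w)"

text \<open>The line \<open>FZ\<close> bisects the angle \<open>\<angle>PFQ\<close> if reflection in it maps the ray \<open>FP\<close> to the ray \<open>FQ\<close>,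
  where rays may wrap around the plane and \<open>F\<close> is the focus of \<open>K\<close>.\<close>

definition bisects_angle :: "focal_conic \<Rightarrow> complex \<Rightarrow> xpoint \<Rightarrow> xpoint \<Rightarrow> bool" where
  "bisects_angle K Z P Q \<longleftrightarrow>
     Z \<noteq> focus K \<and>
     (\<exists>u v. on_ray K u P \<and> on_ray K v Q \<and> mirror 0 (Z - focus K) u = v)"

text \<open>\<open>m\<^sub>1\<close>, \<open>m\<^sub>2\<close>, \<open>l\<^sub>1\<close> and \<open>l\<^sub>2\<close> are lines through \<open>Z\<close>; a bisector of the angle formed by \<open>l\<^sub>1\<close> and \<open>l\<^sub>2\<close>
  is a line through \<open>Z\<close> in which they are mirror images of each other.\<close>

definition isogonal ::
  "complex \<Rightarrow> complex set \<Rightarrow> complex set \<Rightarrow> complex set \<Rightarrow> complex set \<Rightarrow> bool" where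
  "isogonal Z m\<^sub>1 m\<^sub>2 l\<^sub>1 l\<^sub>2 \<longleftrightarrow>
     (\<exists>w. w \<noteq> 0 \<and> mirror Z w ` l\<^sub>1 = l\<^sub>2 \<and> mirror Z w ` m\<^sub>1 = m\<^sub>2)"

end

theory Submission
  imports Defs
begin

text \<open>For a conic \<open>r (a + b \<bullet> u) = c\<close> with focus at the origin, the tangent at the point in direction
  \<open>m\<close> is the line \<open>(b + a m) \<bullet> X = c\<close>, and the chord between the points in directions
  \<open>cis (- \<theta>) w\<close> and \<open>cis \<theta> w\<close> is the line \<open>(cos \<theta> b + a w) \<bullet> X = c cos \<theta>\<close>. So if \<open>Z\<close> lies on two
  tangents or on two such chords with the same \<open>\<theta>\<close>, then \<open>Z\<close> is orthogonal to the difference of the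
  two unit vectors \<open>m\<close>, respectively \<open>w\<close>, and the reflection in \<open>FZ\<close> exchanges them. This gives the
  three bisection claims.

  For isogonality, the coefficients of the inscribed conic are determined up to a factor by its
  points, hence are known in terms of its second focus \<open>F'\<close>. The mirror images \<open>P\<^sub>i\<close> and \<open>P\<^sub>j\<close> of \<open>F'\<close>
  in the two tangents lie on a circle about \<open>F\<close> and on a circle about \<open>Z\<close>, so \<open>FZ\<close> is a bisector of
  the angle \<open>P\<^sub>i Z P\<^sub>j\<close>, while the sides are bisectors of \<open>P\<^sub>i Z F'\<close> and \<open>P\<^sub>j Z F'\<close>; the claim
  is then a comparison of arguments of complex numbers.\<close>

section \<open>Reflections and lines in the complex plane\<close>

text \<open>Equal norms make \<open>u + v\<close> orthogonal to \<open>u - v\<close>, and so is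
  \<open>z\<close>. As \<open>u - v\<close> is nonzero, \<open>z\<close> is parallel to
  \<open>u + v\<close>, so the reflection fixes \<open>u + v\<close> and negates
  \<open>u - v\<close>.\<close>

lemma mirror_swaps:
  fixes z u v :: complex
  assumes "z \<noteq> 0" "norm u = norm v" "u \<noteq> v" "z \<bullet> u = z \<bullet> v"
  shows "z * cnj u = v * cnj z" and "mirror 0 z u = v"
proof -
  obtain x y where z: "z = Complex x y" by (cases z)
  obtain p q where u: "u = Complex p q" by (cases u)
  obtain r s where v: "v = Complex r s" by (cases v)
  have 1: "x * (p - r) + y * (q - s) = 0"
    using assms(4) by (simp add: z u v inner_complex_def algebra_simps)
  have "(norm u)\<^sup>2 = (norm v)\<^sup>2" using assms(2) by simp
  then have 2: "(p - r) * (p + r) + (q - s) * (q + s) = 0"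
    unfolding u v cmod_power2 by (simp add: power2_eq_square algebra_simps)
  have "(p - r) * (y * (p + r) - x * (q + s)) = 0" "(q - s) * (y * (p + r) - x * (q + s)) = 0"
    using 1 2 by algebra+
  then have "y * (p + r) = x * (q + s)"
    using assms(3) by (auto simp: u v)
  then show *: "z * cnj u = v * cnj z"
    using 1 by (simp add: z u v complex_eq_iff algebra_simps)
  show "mirror 0 z u = v"
    using * assms(1) by (simp add: mirror_def)
qed

lemma orthogonal_complexE:
  fixes n x :: complex
  assumes "n \<noteq> 0" "n \<bullet> x = 0"
  obtains t where "x = t *\<^sub>R (\<i> * n)"
proof -
  define D T where "D = (Re n)\<^sup>2 + (Im n)\<^sup>2" and "T = Re n * Im x - Im n * Re x"
  have eq: "Re n * Re x + Im n * Im x = 0"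
    using assms(2) by (simp add: inner_complex_def)
  have "D \<noteq> 0"
    using assms(1) by (simp add: D_def complex_eq_iff sum_power2_eq_zero_iff)
  moreover have "Re x * D = - T * Im n" "Im x * D = T * Re n"
    unfolding D_def T_def using eq by algebra+
  ultimately have "x = (T / D) *\<^sub>R (\<i> * n)"
    by (simp add: complex_eq_iff field_simps)
  then show thesis by (rule that)
qed

lemma affine_hull_eq_line:
  fixes A B F n :: complex
  assumes "A \<noteq> B" "n \<noteq> 0" "n \<bullet> (A - F) = c" "n \<bullet> (B - F) = c"
  shows "affine hull {A, B} = {X. n \<bullet> (X - F) = c}"
proof (intro set_eqI iffI)
  fix X assume "X \<in> affine hull {A, B}"
  then obtain t where "X = A + t *\<^sub>R (B - A)"
    by (auto simp: affine_hull_2_alt)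
  then have "X - F = (A - F) + t *\<^sub>R ((B - F) - (A - F))" by simp
  then have "n \<bullet> (X - F) = n \<bullet> (A - F) + t * (n \<bullet> (B - F) - n \<bullet> (A - F))"
    by (simp only: inner_add_right inner_diff_right inner_scaleR_right)
  then show "X \<in> {X. n \<bullet> (X - F) = c}" using assms by simp
next
  fix X assume X: "X \<in> {X. n \<bullet> (X - F) = c}"
  have "n \<bullet> (X - A) = 0" "n \<bullet> (B - A) = 0"
    using X assms(3,4) by (simp_all add: inner_diff_right)
  then obtain t s where t: "X - A = t *\<^sub>R (\<i> * n)" and s: "B - A = s *\<^sub>R (\<i> * n)"
    using orthogonal_complexE[OF assms(2)] by metis
  have "s \<noteq> 0" using s assms(1) by auto
  then have "X - A = (t / s) *\<^sub>R (B - A)" unfolding t s by simp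
  then have "X = A + (t / s) *\<^sub>R (B - A)" by (simp add: algebra_simps)
  then show "X \<in> affine hull {A, B}" unfolding affine_hull_2_alt by blast
qed

lemma line_through_normal:
  fixes Z n F :: complex
  assumes "n \<noteq> 0" "n \<bullet> (Z - F) = c"
  shows "affine hull {Z, Z + \<i> * n} = {X. n \<bullet> (X - F) = c}"
proof (rule affine_hull_eq_line)
  have "n \<bullet> (\<i> * n) = 0" by (simp add: inner_complex_def)
  then show "n \<bullet> (Z + \<i> * n - F) = c"
    using assms(2) by (simp add: inner_diff_right inner_add_right)
qed (use assms in auto)

section \<open>Tangents of a conic in terms of a focus\<close>

lemma quadratic_coeffs_eq:
  fixes p q r p' q' r' :: real
  assumes "\<And>t. p + q * t + r * t\<^sup>2 = p' + q' * t + r' * t\<^sup>2"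
  shows "p = p'" "q = q'" "r = r'"
  using assms[of 0] assms[of 1] assms[of "-1"] by simp_all

lemma conic_form_line:
  "conic_form K (A + of_real t * d) =
     ((coef_r K)\<^sup>2 * (norm (A - focus K))\<^sup>2 - (coef_0 K - coef_x K \<bullet> (A - focus K))\<^sup>2)
     + (2 * (coef_r K)\<^sup>2 * ((A - focus K) \<bullet> d)
        + 2 * (coef_0 K - coef_x K \<bullet> (A - focus K)) * (coef_x K \<bullet> d)) * t
     + ((coef_r K)\<^sup>2 * (norm d)\<^sup>2 - (coef_x K \<bullet> d)\<^sup>2) * t\<^sup>2"
proof -
  define y where "y = A - focus K"
  have e: "A + of_real t * d - focus K = y + t *\<^sub>R d"
    by (simp add: y_def scaleR_conv_of_real)
  have "(norm (y + t *\<^sub>R d))\<^sup>2 = (norm y)\<^sup>2 + 2 * t * (y \<bullet> d) + t\<^sup>2 * (norm d)\<^sup>2"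
    unfolding power2_norm_eq_inner
    by (simp add: inner_add_left inner_add_right inner_commute power2_eq_square algebra_simps)
  then show ?thesis
    unfolding conic_form_def e y_def[symmetric] power_mult_distrib inner_add_right inner_scaleR_right
    by (simp add: power2_eq_square algebra_simps)
qed

text \<open>Comparing coefficients in the parameter of the line, tangency at a proper point kills
  the constant and linear terms of \<open>conic_form\<close>, tangency at infinity the linear and
  quadratic ones. In both cases one equation shows that \<open>m\<close> is a unit vector and the
  other gives the normal \<open>b + a m\<close>.\<close>

lemma tangent_at_line:
  assumes "nondegenerate_conic K" "tangent_at K L P"
  obtains m where "on_ray K m P"
    "coef_x K + coef_r K *\<^sub>R m \<noteq> 0"
    "L = {X. (coef_x K + coef_r K *\<^sub>R m) \<bullet> (X - focus K) = coef_0 K}"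
proof -
  define a b c F where "a = coef_r K" and "b = coef_x K" and "c = coef_0 K" and "F = focus K"
  note defs = a_def[symmetric] b_def[symmetric] c_def[symmetric] F_def[symmetric]
  have ac: "a > 0" "c > 0" using assms(1) by (simp_all add: nondegenerate_conic_def a_def c_def)
  have "\<exists>m A d. on_ray K m P \<and> d \<noteq> 0 \<and> L = affine hull {A, A + d}
          \<and> (b + a *\<^sub>R m) \<bullet> (A - F) = c \<and> (b + a *\<^sub>R m) \<bullet> d = 0"
  proof (cases P)
    case (Proper A)
    then obtain d k where d: "d \<noteq> 0" and L: "L = affine hull {A, A + d}"
      and f: "\<And>t. conic_form K (A + of_real t * d) = k * t\<^sup>2"
      using assms(2) by auto
    define y where "y = A - F"
    have q: "a\<^sup>2 * (norm y)\<^sup>2 - (c - b \<bullet> y)\<^sup>2 = 0"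
      "2 * a\<^sup>2 * (y \<bullet> d) + 2 * (c - b \<bullet> y) * (b \<bullet> d) = 0"
      using quadratic_coeffs_eq[of _ _ _ 0 0 k, unfolded add_0_left mult_zero_left,
          OF f[unfolded conic_form_line defs]] by (simp_all add: y_def)
    \<comment> \<open>The signed radius dictated by the polar equation; it is negative if the point
      of contact is reached only by a ray that wraps around. It is nonzero because
      \<open>c > 0\<close>.\<close>
    define r where "r = (c - b \<bullet> y) / a"
    have ar: "a * r = c - b \<bullet> y" using ac by (simp add: r_def)
    have "a\<^sup>2 * (norm y)\<^sup>2 = a\<^sup>2 * r\<^sup>2"
      using q(1) by (simp add: ar[symmetric] power_mult_distrib)
    then have ry: "r\<^sup>2 = (norm y)\<^sup>2" using ac by simp
    have r0: "r \<noteq> 0"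
      using ry ar ac by auto
    define m where "m = (1 / r) *\<^sub>R y"
    have y: "y = r *\<^sub>R m" using r0 by (simp add: m_def)
    have "\<bar>r\<bar> = norm y" using ry power2_eq_iff[of r "norm y"] by (auto simp: abs_if)
    then have nm: "norm m = 1" using r0 by (auto simp: m_def)
    have "A = F + of_real r * m"
      using y by (simp add: y_def scaleR_conv_of_real algebra_simps)
    moreover have rc: "r * (a + b \<bullet> m) = c"
      using ar unfolding y by (simp add: algebra_simps)
    ultimately have ray: "on_ray K m P"
      using nm r0 by (auto simp: Proper defs)
    have "m \<bullet> m = 1" using nm by (simp add: norm_eq_1)
    then have 1: "(b + a *\<^sub>R m) \<bullet> (A - F) = c"
      using rc unfolding y_def[symmetric] y by (simp add: algebra_simps)
    have "2 * a * r * (a * (m \<bullet> d) + b \<bullet> d) = 0"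
      using q(2) unfolding ar[symmetric] unfolding y
      by (simp add: power2_eq_square algebra_simps)
    then have "(b + a *\<^sub>R m) \<bullet> d = 0" using ac r0 by (simp add: inner_add_left)
    then show ?thesis using ray d L 1 by blast
  next
    case (Ideal d)
    then obtain A k where d: "d \<noteq> 0" and L: "L = affine hull {A, A + d}"
      and f: "\<And>t. conic_form K (A + of_real t * d) = k"
      using assms(2) by auto
    define y where "y = A - F"
    have q: "2 * a\<^sup>2 * (y \<bullet> d) + 2 * (c - b \<bullet> y) * (b \<bullet> d) = 0"
      "a\<^sup>2 * (norm d)\<^sup>2 - (b \<bullet> d)\<^sup>2 = 0"
      using quadratic_coeffs_eq[of _ _ _ k 0 0, unfolded add_0_right mult_zero_left,
          OF f[unfolded conic_form_line defs]] by (simp_all add: y_def)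
    \<comment> \<open>The signed length of \<open>d\<close> for which the unit vector
      \<open>m = d / r\<close> satisfies \<open>a + b \<bullet> m = 0\<close>, as the direction of
      an asymptote must.\<close>
    define r where "r = - (b \<bullet> d) / a"
    have ar: "b \<bullet> d = - a * r" using ac by (simp add: r_def)
    have "a\<^sup>2 * (norm d)\<^sup>2 = a\<^sup>2 * r\<^sup>2" using q(2) by (simp add: ar power_mult_distrib)
    then have ry: "r\<^sup>2 = (norm d)\<^sup>2" using ac by simp
    have r0: "r \<noteq> 0" using ry d by auto
    define m where "m = (1 / r) *\<^sub>R d"
    have dm: "d = r *\<^sub>R m" using r0 by (simp add: m_def)
    have "\<bar>r\<bar> = norm d" using ry power2_eq_iff[of r "norm d"] by (auto simp: abs_if)
    then have nm: "norm m = 1" using r0 by (auto simp: m_def)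
    have "r * (b \<bullet> m) = r * (- a)" using ar unfolding dm by (simp add: mult.commute)
    then have bm: "b \<bullet> m = - a" using r0 mult_left_cancel by blast
    have ray: "on_ray K m P"
      using nm bm r0 dm by (auto simp: Ideal defs scaleR_conv_of_real)
    have "m \<bullet> m = 1" using nm by (simp add: norm_eq_1)
    then have 2: "(b + a *\<^sub>R m) \<bullet> d = 0"
      using bm unfolding dm by (simp add: inner_add_left)
    have "2 * a * r * (a * (m \<bullet> y) + b \<bullet> y - c) = 0"
      using q(1) unfolding ar unfolding dm
      by (simp add: power2_eq_square algebra_simps inner_commute)
    then have "(b + a *\<^sub>R m) \<bullet> (A - F) = c"
      using ac r0 by (simp add: inner_add_left y_def)
    then show ?thesis using ray d L 2 by blast
  qed
  then obtain m A d where *: "on_ray K m P" "d \<noteq> 0" "L = affine hull {A, A + d}"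
    "(b + a *\<^sub>R m) \<bullet> (A - F) = c" "(b + a *\<^sub>R m) \<bullet> d = 0" by blast
  have n0: "b + a *\<^sub>R m \<noteq> 0" using *(4) ac by auto
  have "L = {X. (b + a *\<^sub>R m) \<bullet> (X - F) = c}"
    unfolding *(3)
  proof (rule affine_hull_eq_line[OF _ n0 *(4)])
    have "A + d - F = (A - F) + d" by simp
    then show "(b + a *\<^sub>R m) \<bullet> (A + d - F) = c"
      using *(4,5) by (metis add.right_neutral inner_add_right)
  qed (use *(2) in simp)
  then show thesis using that *(1) n0 by (simp add: defs)
qed

section \<open>Sides of a discrete conic as chords\<close>

text \<open>Serves to exclude the degenerate cases below, in which both ends of a side lie on one
  line through the focus, which then lies on the side.\<close>

lemma focus_notin_side_not_parallel:
  assumes "F \<notin> affine hull {A, B}" "A \<noteq> B"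
    "A = F + of_real r * u" "B = F + of_real s * u"
  shows False
proof -
  have "r \<noteq> s" using assms by auto
  have "A + (r / (r - s)) *\<^sub>R (B - A) = F + of_real (r + (r / (r - s)) * (s - r)) * u"
    unfolding assms(3,4) scaleR_conv_of_real
    by (simp only: of_real_add of_real_mult of_real_diff) (simp add: algebra_simps)
  also have "r + (r / (r - s)) * (s - r) = 0" using \<open>r \<noteq> s\<close> by (simp add: field_simps)
  finally have "F = A + (r / (r - s)) *\<^sub>R (B - A)" by simp
  then show False using assms(1) unfolding affine_hull_2_alt by blast
qed

text \<open>\<open>\<theta>\<close> is half of the constant angle of the discrete conic, and \<open>w k\<close> is the direction of the
  bisector of the angle subtended at the focus by the \<open>k\<close>-th side.\<close>

lemma discrete_conic_sides:
  assumes D: "discrete_conic C n V"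
    and nf: "\<And>k. k \<in> {1..n} \<Longrightarrow> focus C \<notin> side V k"
  obtains \<theta> w e where
    "\<And>k. k \<in> {1..n} \<Longrightarrow> on_ray C (cis (- \<theta>) * w k) (Proper (V k))"
    "\<And>k. k \<in> {1..n} \<Longrightarrow> on_ray C (cis \<theta> * w k) (Proper (V (k + 1)))"
    "\<And>k. k \<in> {1..n} \<Longrightarrow>
      side V k = {X. (cos \<theta> *\<^sub>R coef_x C + coef_r C *\<^sub>R w k) \<bullet> (X - focus C) = e}"
proof -
  define a b c F where "a = coef_r C" and "b = coef_x C" and "c = coef_0 C" and "F = focus C"
  note defs = a_def[symmetric] b_def[symmetric] c_def[symmetric] F_def[symmetric]
  from D obtain \<theta>2 where \<theta>2: "\<And>k. k \<in> {1..n} \<Longrightarrow> ray_angle C (V k) (V (k + 1)) \<theta>2"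
    unfolding discrete_conic_def by blast
  have n3: "n \<ge> 3" and ne: "\<And>k. k \<in> {1..n} \<Longrightarrow> V k \<noteq> V (k + 1)" and ab: "a \<noteq> 0 \<or> b \<noteq> 0"
    using D by (auto simp: discrete_conic_def conic_def a_def b_def)
  define \<theta> where "\<theta> = \<theta>2 / 2"
  have "\<exists>u. \<forall>k\<in>{1..n}. on_ray C (u k) (Proper (V k))
          \<and> on_ray C (cis \<theta>2 * u k) (Proper (V (k + 1)))"
    using \<theta>2 unfolding ray_angle_def by (intro bchoice) blast
  \<comment> \<open>If \<open>C\<close> is a line, \<open>u (k + 1)\<close> and
    \<open>cis \<theta>2 * u k\<close> may be opposite directions for the same vertex. This does no
    harm, since every side is treated with its own directions.\<close>
  then obtain u where u: "\<And>k. k \<in> {1..n} \<Longrightarrow> on_ray C (u k) (Proper (V k))"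
    "\<And>k. k \<in> {1..n} \<Longrightarrow> on_ray C (cis \<theta>2 * u k) (Proper (V (k + 1)))" by blast
  define w where "w k = cis \<theta> * u k" for k
  have uw: "u k = cis (- \<theta>) * w k" "cis \<theta>2 * u k = cis \<theta> * w k" for k
    by (simp_all add: w_def \<theta>_def cis_mult mult.assoc[symmetric])
  have ray: "on_ray C (cis (- \<theta>) * w k) (Proper (V k))"
    "on_ray C (cis \<theta> * w k) (Proper (V (k + 1)))" if "k \<in> {1..n}" for k
    using u(1)[OF that, unfolded uw(1)] u(2)[OF that, unfolded uw(2)] by blast+
  define N where "N k = cos \<theta> *\<^sub>R b + a *\<^sub>R w k" for k
  have rot: "w k \<bullet> (cis \<psi> * w k) = cos \<psi> * (w k \<bullet> w k)" for k \<psi>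
    by (simp add: inner_complex_def algebra_simps)
  \<comment> \<open>Only \<open>cos \<psi>\<close> enters, so the cases
    \<open>\<psi> = - \<theta>\<close> and \<open>\<psi> = \<theta>\<close> put both ends of the
    side on the same line.\<close>
  have on: "N k \<bullet> (X - F) = c * cos \<theta>"
    if "on_ray C (cis \<psi> * w k) (Proper X)" "cos \<psi> = cos \<theta>" for k \<psi> X
  proof -
    from that(1) obtain r where r: "norm (cis \<psi> * w k) = 1" "X = F + of_real r * (cis \<psi> * w k)"
      "r * (a + b \<bullet> (cis \<psi> * w k)) = c"
      unfolding on_ray.simps defs by blast
    have X: "X - F = r *\<^sub>R (cis \<psi> * w k)" unfolding r(2) by (simp add: scaleR_conv_of_real)
    have "w k \<bullet> w k = 1" using r(1) by (simp add: norm_mult norm_eq_1)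
    then have "N k \<bullet> (X - F) = r * (cos \<theta> * (b \<bullet> (cis \<psi> * w k)) + a * cos \<theta>)"
      unfolding X N_def inner_add_left inner_scaleR_left inner_scaleR_right rot
      by (simp add: that(2))
    then show ?thesis using r(3) by (simp add: algebra_simps flip: r(3))
  qed
  have onk: "N k \<bullet> (V k - F) = c * cos \<theta>" "N k \<bullet> (V (k + 1) - F) = c * cos \<theta>"
    if "k \<in> {1..n}" for k
    using on[OF ray(1)[OF that]] on[OF ray(2)[OF that]] by simp_all
  have nonpar: False if k: "k \<in> {1..n}" and "V k = F + of_real r * v" "V (k + 1) = F + of_real s * v"
    for k v r s
    using focus_notin_side_not_parallel[OF _ ne[OF k] that(2,3)] nf[OF k]
    by (simp add: side_def defs)
  have one: "1 \<in> {1..n}" "2 \<in> {1..n}" using n3 by auto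
  \<comment> \<open>Otherwise \<open>\<theta>2\<close> is a straight angle and \<open>F\<close> is
    collinear with \<open>V 1\<close> and \<open>V 2\<close>.\<close>
  have cos0: "cos \<theta> \<noteq> 0"
  proof
    assume c0: "cos \<theta> = 0"
    then have "cis \<theta>2 = -1"
      using cos_double_cos[of \<theta>] sin_double[of \<theta>] by (simp add: \<theta>_def complex_eq_iff)
    then obtain r s where "V 1 = F + of_real r * u 1" "V (1 + 1) = F + of_real s * (- u 1)"
      using u[OF one(1)] by (auto simp: defs)
    then show False using nonpar[OF one(1), of r "u 1" "- s"] by simp
  qed
  \<comment> \<open>If \<open>c = 0\<close>, a nonzero normal \<open>N k\<close> would put both ends
    of the side on a line through \<open>F\<close>. So all normals vanish, whence
    \<open>w 1 = w 2\<close>, and \<open>V 1\<close> and \<open>V 2\<close> lie on one line through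
    \<open>F\<close> after all.\<close>
  have c0: "c \<noteq> 0"
  proof
    assume c0: "c = 0"
    have N0: "N k = 0" if k: "k \<in> {1..n}" for k
    proof (rule ccontr)
      assume "N k \<noteq> 0"
      moreover have "N k \<bullet> (V k - F) = 0" "N k \<bullet> (V (k + 1) - F) = 0"
        using onk[OF k] c0 by simp_all
      ultimately obtain r s where
        "V k - F = r *\<^sub>R (\<i> * N k)" "V (k + 1) - F = s *\<^sub>R (\<i> * N k)"
        using orthogonal_complexE by metis
      then show False
        using nonpar[OF k, of r "\<i> * N k" s] by (simp add: scaleR_conv_of_real algebra_simps)
    qed
    have "a \<noteq> 0" using N0[OF one(1)] ab cos0 by (auto simp: N_def)
    moreover have "a *\<^sub>R w 1 = a *\<^sub>R w 2"
      using N0[OF one(1)] N0[OF one(2)] by (simp add: N_def add_eq_0_iff)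
    ultimately have "w 1 = w 2" by (metis scaleR_left_imp_eq)
    then have "u 2 = u 1" by (simp add: w_def)
    then obtain r s where "V 1 = F + of_real r * u 1" "V (1 + 1) = F + of_real s * u 1"
      using u(1)[OF one(1)] u(1)[OF one(2)] by (auto simp: defs numeral_2_eq_2)
    then show False using nonpar[OF one(1)] by blast
  qed
  have "side V k = {X. N k \<bullet> (X - F) = c * cos \<theta>}" if k: "k \<in> {1..n}" for k
    unfolding side_def
    using onk[OF k] cos0 c0 by (intro affine_hull_eq_line[OF ne[OF k]]) auto
  then show thesis
    using that[of \<theta> w "c * cos \<theta>"] ray by (simp add: N_def defs)
qed

section \<open>Coefficients of a conic recovered from its points\<close>

text \<open>The ends of the latus rectum determine the ratio of the constants. Then every direction
  that is not asymptotic is scaled to a point of the first conic, which shows that \<open>q\<close>,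
  the error in the vector coefficient, is orthogonal to it; enough such directions force
  \<open>q = 0\<close>.\<close>

lemma focal_conic_coeffs_unique:
  fixes b\<^sub>1 b\<^sub>2 :: complex
  assumes "a\<^sub>1 > 0" "c\<^sub>1 > 0" "a\<^sub>2 > 0" "c\<^sub>2 > 0"
    and sub: "\<And>y. a\<^sub>1 * norm y = \<bar>c\<^sub>1 - b\<^sub>1 \<bullet> y\<bar> \<Longrightarrow> a\<^sub>2 * norm y = \<bar>c\<^sub>2 - b\<^sub>2 \<bullet> y\<bar>"
  obtains \<kappa> where "\<kappa> > 0" "a\<^sub>2 = \<kappa> * a\<^sub>1" "b\<^sub>2 = \<kappa> *\<^sub>R b\<^sub>1" "c\<^sub>2 = \<kappa> * c\<^sub>1"
proof -
  define \<kappa> where "\<kappa> = a\<^sub>2 / a\<^sub>1"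
  have \<kappa>: "\<kappa> > 0" "a\<^sub>2 = \<kappa> * a\<^sub>1" using assms by (simp_all add: \<kappa>_def)
  define v where "v = (if b\<^sub>1 = 0 then 1 else \<i> * b\<^sub>1)"
  have v: "v \<noteq> 0" "b\<^sub>1 \<bullet> v = 0" by (auto simp: v_def inner_complex_def)
  \<comment> \<open>\<open>y\<close> and \<open>- y\<close> are the ends of the latus rectum, where
    the linear term of the first conic vanishes.\<close>
  define y where "y = (c\<^sub>1 / (a\<^sub>1 * norm v)) *\<^sub>R v"
  have y: "norm y = c\<^sub>1 / a\<^sub>1" "b\<^sub>1 \<bullet> y = 0"
    using v assms by (simp_all add: y_def)
  have e1: "a\<^sub>2 * norm y = \<bar>c\<^sub>2 - b\<^sub>2 \<bullet> y\<bar>" using sub[of y] y assms by simp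
  have e2: "a\<^sub>2 * norm y = \<bar>c\<^sub>2 + b\<^sub>2 \<bullet> y\<bar>" using sub[of "- y"] y assms by simp
  from e1 e2 have "a\<^sub>2 * norm y = c\<^sub>2" using assms(4) by linarith
  then have c2: "c\<^sub>2 = \<kappa> * c\<^sub>1" using y by (simp add: \<kappa>_def)
  define q where "q = \<kappa> *\<^sub>R b\<^sub>1 - b\<^sub>2"
  have half: "q \<bullet> y = 0 \<or> q \<bullet> y = - 2 * a\<^sub>2 * norm y" if "a\<^sub>1 * norm y \<noteq> - (b\<^sub>1 \<bullet> y)" for y
  proof -
    define D where "D = a\<^sub>1 * norm y + b\<^sub>1 \<bullet> y"
    have D0: "D \<noteq> 0" using that by (simp add: D_def)
    define x where "x = (c\<^sub>1 / D) *\<^sub>R y"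
    have nx: "norm x = c\<^sub>1 * norm y / \<bar>D\<bar>" using assms by (simp add: x_def)
    have "c\<^sub>1 - b\<^sub>1 \<bullet> x = c\<^sub>1 * (a\<^sub>1 * norm y) / D"
      using D0 by (simp add: x_def field_simps) (simp add: D_def algebra_simps)
    then have "a\<^sub>1 * norm x = \<bar>c\<^sub>1 - b\<^sub>1 \<bullet> x\<bar>"
      using assms(1,2) by (simp add: nx abs_mult)
    from sub[OF this] have "a\<^sub>2 * norm x = \<bar>c\<^sub>2 - b\<^sub>2 \<bullet> x\<bar>" .
    also have "c\<^sub>2 - b\<^sub>2 \<bullet> x = c\<^sub>1 * (a\<^sub>2 * norm y + q \<bullet> y) / D"
      using D0 by (simp add: x_def c2 field_simps)
        (simp add: D_def q_def \<kappa>(2) algebra_simps)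
    finally have "a\<^sub>2 * norm y = \<bar>a\<^sub>2 * norm y + q \<bullet> y\<bar>"
      using assms(2) D0 by (simp add: nx abs_mult)
    then show ?thesis by linarith
  qed
  \<comment> \<open>Applying \<open>half\<close> to \<open>y\<close> and to \<open>- y\<close>
    leaves 0 as the only common value.\<close>
  have q: "q \<bullet> y = 0" if "\<bar>b\<^sub>1 \<bullet> y\<bar> \<noteq> a\<^sub>1 * norm y" for y
  proof (cases "y = 0")
    case False
    then have "a\<^sub>2 * norm y > 0" using assms(3) by simp
    moreover have "a\<^sub>1 * norm y \<ge> 0" using assms(1) by simp
    then have "a\<^sub>1 * norm y \<noteq> - (b\<^sub>1 \<bullet> y)" "a\<^sub>1 * norm y \<noteq> b\<^sub>1 \<bullet> y" using that by linarith+
    then have "q \<bullet> y = 0 \<or> q \<bullet> y = - 2 * (a\<^sub>2 * norm y)" "q \<bullet> y = 0 \<or> q \<bullet> y = 2 * (a\<^sub>2 * norm y)"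
      using half[of y] half[of "- y"] by (simp_all add: mult.assoc)
    ultimately show ?thesis by linarith
  qed simp
  have "q = 0"
  proof (cases "b\<^sub>1 = 0")
    case True
    then have "q \<noteq> 0 \<Longrightarrow> q \<bullet> q = 0" using q[of q] assms(1) by simp
    then show ?thesis by auto
  next
    case False
    have orth: "b\<^sub>1 \<bullet> (\<i> * b\<^sub>1) = 0" by (simp add: inner_complex_def)
    have q1: "q \<bullet> (\<i> * b\<^sub>1) = 0" using q[of "\<i> * b\<^sub>1"] orth False assms(1) by (simp add: norm_mult)
    \<comment> \<open>The axis direction \<open>b\<^sub>1\<close> is itself asymptotic for a
      parabola, so it is tilted: \<open>norm x\<close> is \<open>sqrt (a\<^sub>1\<^sup>2 + (norm
      b\<^sub>1)\<^sup>2) * norm b\<^sub>1\<close>, which makes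
      \<open>b\<^sub>1 \<bullet> x < a\<^sub>1 * norm x\<close> for every eccentricity.\<close>
    define x where "x = a\<^sub>1 *\<^sub>R b\<^sub>1 + norm b\<^sub>1 *\<^sub>R (\<i> * b\<^sub>1)"
    have "norm x = norm (Complex a\<^sub>1 (norm b\<^sub>1)) * norm b\<^sub>1"
      unfolding norm_mult[symmetric] x_def
      by (rule arg_cong[of _ _ norm]) (simp add: complex_eq_iff algebra_simps)
    moreover have "norm (Complex a\<^sub>1 (norm b\<^sub>1)) > norm b\<^sub>1"
      unfolding complex_norm by (rule real_less_rsqrt) (use assms(1) in simp)
    ultimately have "norm x > norm b\<^sub>1 * norm b\<^sub>1" using False by simp
    moreover have "b\<^sub>1 \<bullet> x = a\<^sub>1 * (norm b\<^sub>1 * norm b\<^sub>1)"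
      by (simp add: x_def inner_add_right orth flip: power2_norm_eq_inner power2_eq_square)
    ultimately have "q \<bullet> x = 0" using assms(1) by (intro q) (simp add: abs_mult)
    then have "q \<bullet> b\<^sub>1 = 0" using q1 assms(1) by (simp add: x_def inner_add_right)
    then have "b\<^sub>1 \<bullet> q = 0" by (simp add: inner_commute)
    then obtain t where "q = t *\<^sub>R (\<i> * b\<^sub>1)" using orthogonal_complexE[OF False] by metis
    then have "q \<bullet> q = 0" using q1 by simp
    then show ?thesis by simp
  qed
  then show thesis using that \<kappa> c2 by (simp add: q_def)
qed

lemma infdist_line:
  fixes d F X :: complex
  assumes "d \<noteq> 0"
  shows "norm d * infdist X {Y. d \<bullet> (Y - F) = c} = \<bar>c - d \<bullet> (X - F)\<bar>"
proof -
  define S where "S = {Y. d \<bullet> (Y - F) = c}"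
  define \<delta> where "\<delta> = \<bar>c - d \<bullet> (X - F)\<bar> / norm d"
  \<comment> \<open>The foot of the perpendicular from \<open>X\<close>; Cauchy-Schwarz shows that
    no point of the line is closer.\<close>
  define Y where "Y = X + ((c - d \<bullet> (X - F)) / (d \<bullet> d)) *\<^sub>R d"
  have "Y - F = (X - F) + ((c - d \<bullet> (X - F)) / (d \<bullet> d)) *\<^sub>R d" by (simp add: Y_def)
  then have "d \<bullet> (Y - F) = d \<bullet> (X - F) + ((c - d \<bullet> (X - F)) / (d \<bullet> d)) * (d \<bullet> d)"
    by (simp only: inner_add_right inner_scaleR_right)
  then have YS: "Y \<in> S" using assms by (simp add: S_def)
  have "dist X Y = \<delta>"
    using assms by (simp add: Y_def \<delta>_def dist_norm power2_eq_square flip: power2_norm_eq_inner)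
  then have "infdist X S \<le> \<delta>" using infdist_le[OF YS, of X] by simp
  moreover have "\<delta> \<le> infdist X S"
    unfolding infdist_def using YS
  proof (simp, intro conjI impI cINF_greatest)
    fix W assume "W \<in> S"
    then have "c - d \<bullet> (X - F) = d \<bullet> (W - X)" by (auto simp: S_def inner_diff_right)
    then have "\<bar>c - d \<bullet> (X - F)\<bar> \<le> norm d * norm (W - X)"
      using Cauchy_Schwarz_ineq2[of d "W - X"] by simp
    then show "\<delta> \<le> dist X W"
      using assms by (simp add: \<delta>_def dist_norm norm_minus_commute field_simps)
  qed auto
  ultimately show ?thesis using assms by (simp add: \<delta>_def S_def field_simps)
qed

section \<open>Isogonal lines\<close>

text \<open>The reflection turns the direction \<open>d\<close> into
  \<open>w\<^sup>2 * cnj d / (norm w)\<^sup>2\<close>. Only the square of \<open>w\<close> matters,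
  so an axis can be prescribed by a complex square root.\<close>

lemma mirror_image_line:
  assumes "w \<noteq> 0" "w\<^sup>2 * cnj d = of_real \<rho> * e" "\<rho> \<noteq> 0"
  shows "mirror Z w ` (affine hull {Z, Z + d}) = affine hull {Z, Z + e}"
proof -
  define \<sigma> where "\<sigma> = \<rho> / (norm w)\<^sup>2"
  have \<sigma>: "\<sigma> \<noteq> 0" using assms by (simp add: \<sigma>_def)
  have "mirror Z w (Z + t *\<^sub>R d) = Z + (t * \<sigma>) *\<^sub>R e" for t
  proof -
    have "w * cnj (d / w) = of_real \<sigma> * e"
      unfolding \<sigma>_def of_real_divide complex_norm_square
      using assms by (simp add: field_simps power2_eq_square)
    then show ?thesis by (simp add: mirror_def scaleR_conv_of_real mult.assoc
          mult.left_commute[of w] flip: times_divide_eq_right)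
  qed
  note m = this
  show ?thesis
  proof (intro set_eqI iffI)
    fix X assume "X \<in> mirror Z w ` (affine hull {Z, Z + d})"
    then obtain t where "X = Z + (t * \<sigma>) *\<^sub>R e" unfolding affine_hull_2_alt using m by auto
    then show "X \<in> affine hull {Z, Z + e}" unfolding affine_hull_2_alt by auto
  next
    fix X assume "X \<in> affine hull {Z, Z + e}"
    then obtain t where "X = Z + t *\<^sub>R e" unfolding affine_hull_2_alt by auto
    then have "X = mirror Z w (Z + (t / \<sigma>) *\<^sub>R d)" using m \<sigma> by simp
    then show "X \<in> mirror Z w ` (affine hull {Z, Z + d})" unfolding affine_hull_2_alt by auto
  qed
qed

text \<open>For a conic with two proper foci, \<open>Z + p\<^sub>k\<close> is the mirror image of the second focus \<open>Z + h\<close> in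
  the \<open>k\<close>-th tangent; for a parabola \<open>h\<close> is the direction of the axis.\<close>

lemma isogonal_if_reflections:
  fixes F Z h p\<^sub>1 p\<^sub>2 :: complex
  assumes Z: "Z \<noteq> F" and h: "h \<noteq> 0"
    and p: "norm p\<^sub>1 = norm h" "norm p\<^sub>2 = norm h" "p\<^sub>1 \<noteq> p\<^sub>2" "p\<^sub>1 \<noteq> h" "p\<^sub>2 \<noteq> h"
    and orth: "(Z - F) \<bullet> p\<^sub>1 = (Z - F) \<bullet> p\<^sub>2"
  shows "isogonal Z (affine hull {Z, F}) (affine hull {Z, Z + h})
           (affine hull {Z, Z + \<i> * (p\<^sub>1 - h)}) (affine hull {Z, Z + \<i> * (p\<^sub>2 - h)})"
proof -
  define z where "z = Z - F"
  have z: "z \<noteq> 0" using Z by (simp add: z_def)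
  define n\<^sub>1 n\<^sub>2 where "n\<^sub>1 = p\<^sub>1 - h" and "n\<^sub>2 = p\<^sub>2 - h"
  have n0: "n\<^sub>1 \<noteq> 0" "n\<^sub>2 \<noteq> 0" using p by (simp_all add: n\<^sub>1_def n\<^sub>2_def)
  have sw: "z * cnj p\<^sub>1 = p\<^sub>2 * cnj z"
    using mirror_swaps(1)[OF z, of p\<^sub>1 p\<^sub>2] p orth by (simp add: z_def)
  have pp: "p\<^sub>1 * cnj p\<^sub>1 = h * cnj h" "p\<^sub>2 * cnj p\<^sub>2 = h * cnj h"
    using p(1,2) by (metis complex_norm_square)+
  have p0: "p\<^sub>1 \<noteq> 0" "p\<^sub>2 \<noteq> 0" using p h by auto
  have c: "p\<^sub>1 * cnj n\<^sub>1 = - cnj h * n\<^sub>1" "p\<^sub>2 * cnj n\<^sub>2 = - cnj h * n\<^sub>2"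
    using pp by (simp_all add: n\<^sub>1_def n\<^sub>2_def algebra_simps)
  \<comment> \<open>\<open>S\<close> is real iff \<open>z * h\<close> and
    \<open>n\<^sub>1 * n\<^sub>2\<close> have the same argument modulo \<open>pi\<close>, that is,
    iff the lines with directions \<open>z\<close> and \<open>h\<close> have the same bisectors as
    the two sides.\<close>
  define S where "S = z * h * cnj n\<^sub>1 * cnj n\<^sub>2"
  have "p\<^sub>1 * p\<^sub>2 * S = p\<^sub>1 * p\<^sub>2 * cnj S"
  proof -
    have "p\<^sub>1 * p\<^sub>2 * S = z * h * (p\<^sub>1 * cnj n\<^sub>1) * (p\<^sub>2 * cnj n\<^sub>2)" by (simp add: S_def)
    also have "\<dots> = (z * (h * cnj h)) * cnj h * n\<^sub>1 * n\<^sub>2" unfolding c by simp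
    also have "z * (h * cnj h) = p\<^sub>1 * (p\<^sub>2 * cnj z)" unfolding pp(1)[symmetric] sw[symmetric] by simp
    finally show ?thesis by (simp add: S_def mult.assoc)
  qed
  then have "cnj S = S" using p0 by simp
  then obtain \<tau> where \<tau>: "S = of_real \<tau>" by (metis Reals_cnj_iff Reals_cases)
  define \<rho> where "\<rho> = - \<tau> / (norm n\<^sub>2)\<^sup>2"
  have "S \<noteq> 0" using z h n0 by (simp add: S_def)
  then have \<rho>0: "\<rho> \<noteq> 0" using \<tau> n0 by (simp add: \<rho>_def)
  \<comment> \<open>A bisector direction of \<open>z\<close> and \<open>h\<close>: since
    \<open>z * h * cnj z\<close> is a real multiple of \<open>h\<close>, this reflection maps
    \<open>FZ\<close> to the line with direction \<open>h\<close>.\<close>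
  define w where "w = csqrt (z * h)"
  have w: "w \<noteq> 0" "w\<^sup>2 = z * h" using z h by (simp_all add: w_def)
  have "of_real \<rho> * n\<^sub>2 * cnj n\<^sub>2 = - S"
    unfolding \<rho>_def \<tau> of_real_divide complex_norm_square using n0 by simp
  then have "(of_real \<rho> * n\<^sub>2) * cnj n\<^sub>2 = (- z * h * cnj n\<^sub>1) * cnj n\<^sub>2" by (simp add: S_def)
  then have "of_real \<rho> * n\<^sub>2 = - z * h * cnj n\<^sub>1"
    using n0 by (metis complex_cnj_zero_iff mult_right_cancel)
  then have "w\<^sup>2 * cnj (\<i> * n\<^sub>1) = of_real \<rho> * (\<i> * n\<^sub>2)"
    unfolding w by (simp add: algebra_simps)
  from mirror_image_line[OF w(1) this \<rho>0]
  have "mirror Z w ` (affine hull {Z, Z + \<i> * n\<^sub>1}) = affine hull {Z, Z + \<i> * n\<^sub>2}" .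
  moreover have "w\<^sup>2 * cnj (F - Z) = of_real (- ((norm z)\<^sup>2)) * h"
    unfolding w of_real_minus complex_norm_square by (simp add: z_def algebra_simps)
  from mirror_image_line[OF w(1) this, of Z]
  have "mirror Z w ` (affine hull {Z, F}) = affine hull {Z, Z + h}" using z by simp
  ultimately show ?thesis
    using w(1) unfolding isogonal_def n\<^sub>1_def n\<^sub>2_def by blast
qed

lemma affine_hull_direction_scaleR:
  fixes Z d :: complex
  assumes "t \<noteq> 0"
  shows "affine hull {Z, Z + t *\<^sub>R d} = affine hull {Z, Z + d}"
proof (intro set_eqI iffI)
  fix X assume "X \<in> affine hull {Z, Z + t *\<^sub>R d}"
  then show "X \<in> affine hull {Z, Z + d}" unfolding affine_hull_2_alt by auto
next
  fix X assume "X \<in> affine hull {Z, Z + d}"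
  then obtain s where "X = Z + s *\<^sub>R d" unfolding affine_hull_2_alt by auto
  then have "X = Z + (s / t) *\<^sub>R (Z + t *\<^sub>R d - Z)" using assms by simp
  then show "X \<in> affine hull {Z, Z + t *\<^sub>R d}" unfolding affine_hull_2_alt by blast
qed

text \<open>The normal of a tangent points along the difference between \<open>F'\<close> and its
  mirror image; for a parabola, between the axis direction and the direction of the focal radius,
  scaled to equal length. The different types of conic thus reduce to
  \<open>isogonal_if_reflections\<close>.\<close>

lemma isogonal_tangents:
  fixes K :: focal_conic and Z m\<^sub>1 m\<^sub>2 :: complex
  defines "N \<equiv> \<lambda>m. coef_x K + coef_r K *\<^sub>R m"
  assumes K: "nondegenerate_conic K" and F': "other_focus K F'"
    and m: "norm m\<^sub>1 = 1" "norm m\<^sub>2 = 1" "m\<^sub>1 \<noteq> m\<^sub>2"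
    and Z: "N m\<^sub>1 \<bullet> (Z - focus K) = coef_0 K" "N m\<^sub>2 \<bullet> (Z - focus K) = coef_0 K"
  shows "isogonal Z (affine hull {Z, focus K}) (line_to Z F')
           {X. N m\<^sub>1 \<bullet> (X - focus K) = coef_0 K} {X. N m\<^sub>2 \<bullet> (X - focus K) = coef_0 K}"
proof -
  define a b c F where "a = coef_r K" and "b = coef_x K" and "c = coef_0 K" and "F = focus K"
  note defs = a_def[symmetric] b_def[symmetric] c_def[symmetric] F_def[symmetric]
  have ac: "a > 0" "c > 0" using K by (simp_all add: nondegenerate_conic_def a_def c_def)
  have N: "N m = b + a *\<^sub>R m" for m by (simp add: N_def defs)
  define z where "z = Z - F"
  have Nz: "N m\<^sub>1 \<bullet> z = c" "N m\<^sub>2 \<bullet> z = c" using Z by (simp_all add: z_def defs)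
  have cK: "conic K" using ac by (simp add: conic_def defs)
  have pts: "F + y \<in> conic_points K" if "a * norm y = \<bar>c - b \<bullet> y\<bar>" for y
    using that unfolding conic_points_focus_directrix[OF cK] by (simp add: defs dist_norm)
  have main: ?thesis
    if "h \<noteq> 0" "\<mu> \<noteq> 0" "norm p\<^sub>1 = norm h" "norm p\<^sub>2 = norm h" "p\<^sub>1 \<noteq> p\<^sub>2"
      "N m\<^sub>1 = \<mu> *\<^sub>R (p\<^sub>1 - h)" "N m\<^sub>2 = \<mu> *\<^sub>R (p\<^sub>2 - h)"
      "line_to Z F' = affine hull {Z, Z + h}" for h \<mu> p\<^sub>1 p\<^sub>2
  proof -
    have ne: "p\<^sub>1 \<noteq> h" "p\<^sub>2 \<noteq> h" "Z \<noteq> F" using Nz that ac by (auto simp: z_def)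
    have pz: "(p\<^sub>1 - h) \<bullet> z = c / \<mu>" "(p\<^sub>2 - h) \<bullet> z = c / \<mu>"
      using Nz that(2) unfolding that(6,7) inner_scaleR_left by (simp_all add: field_simps)
    then have "z \<bullet> p\<^sub>1 = z \<bullet> p\<^sub>2" unfolding inner_diff_left inner_commute[of z] by linarith
    then have iso: "isogonal Z (affine hull {Z, F}) (affine hull {Z, Z + h})
           (affine hull {Z, Z + \<i> * (p\<^sub>1 - h)}) (affine hull {Z, Z + \<i> * (p\<^sub>2 - h)})"
      using isogonal_if_reflections[of Z F h p\<^sub>1 p\<^sub>2] ne that by (simp add: z_def)
    have "{X. N m\<^sub>1 \<bullet> (X - F) = c} = affine hull {Z, Z + \<i> * (p\<^sub>1 - h)}"
      "{X. N m\<^sub>2 \<bullet> (X - F) = c} = affine hull {Z, Z + \<i> * (p\<^sub>2 - h)}"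
      using line_through_normal[of "p\<^sub>1 - h" Z F "c / \<mu>"] line_through_normal[of "p\<^sub>2 - h" Z F "c / \<mu>"]
        pz ne that(2) unfolding that(6,7) inner_scaleR_left
      by (simp_all add: z_def field_simps)
    then show ?thesis using iso by (simp add: that(8) defs)
  qed
  show ?thesis
  proof (cases F')
    case (Proper G)
    define g where "g = G - F"
    \<comment> \<open>The mirror image of \<open>G\<close> in the tangent is \<open>F + s m\<close>.
      An ellipse gives a positive \<open>s\<close>, its sum of focal distances; a hyperbola gives
      minus its difference.\<close>
    have proper: ?thesis if s: "s \<noteq> 0" "\<mu> \<noteq> 0" "a = \<mu> * s" "b = - \<mu> *\<^sub>R g"
      "2 * c = \<mu> * (s\<^sup>2 - (norm g)\<^sup>2)" for s \<mu>
    proof -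
      have Nm: "N m = \<mu> *\<^sub>R ((s *\<^sub>R m - z) - (g - z))" for m
        by (simp add: N that algebra_simps)
      \<comment> \<open>\<open>Z\<close> lies on the tangent, hence is equidistant from
        \<open>G\<close> and its mirror image.\<close>
      have nrm: "norm (s *\<^sub>R m - z) = norm (g - z)" if "norm m = 1" "N m \<bullet> z = c" for m
      proof -
        have "\<mu> * (2 * ((s *\<^sub>R m - g) \<bullet> z)) = \<mu> * (s\<^sup>2 - (norm g)\<^sup>2)"
          using that(2) unfolding s(5)[symmetric] Nm by (simp add: algebra_simps)
        then have "2 * ((s *\<^sub>R m - g) \<bullet> z) = s\<^sup>2 - (norm g)\<^sup>2" using s(2) by simp
        moreover have "m \<bullet> m = 1" using that by (simp add: norm_eq_1)
        ultimately have "(norm (s *\<^sub>R m - z))\<^sup>2 = (norm (g - z))\<^sup>2"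
          unfolding power2_norm_eq_inner
          by (simp add: inner_diff_left inner_diff_right inner_commute power2_eq_square algebra_simps)
        then show ?thesis by simp
      qed
      have p: "norm (s *\<^sub>R m\<^sub>1 - z) = norm (g - z)" "norm (s *\<^sub>R m\<^sub>2 - z) = norm (g - z)"
        using nrm m Nz by blast+
      have ne: "s *\<^sub>R m\<^sub>1 - z \<noteq> s *\<^sub>R m\<^sub>2 - z" using m s by simp
      then have "g - z \<noteq> 0" using p by auto
      moreover have "line_to Z F' = affine hull {Z, Z + (g - z)}"
        by (simp add: Proper g_def z_def)
      ultimately show ?thesis using main s(2) p ne Nm by blast
    qed
    have sq: "(norm (y - g))\<^sup>2 = (norm y)\<^sup>2 - 2 * (g \<bullet> y) + (norm g)\<^sup>2" for y
      unfolding power2_norm_eq_inner by (simp add: inner_diff_left inner_diff_right inner_commute)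
    have dst: "dist (F + y) F = norm y" "dist (F + y) G = norm (y - g)" for y
      by (simp_all add: dist_norm g_def algebra_simps)
    from F' consider
      (ell) s where "s > norm g" "conic_points K = {X. dist X F + dist X G = s}"
      | (hyp) s where "0 < s" "s < norm g" "conic_points K = {X. \<bar>dist X F - dist X G\<bar> = s}"
      by (auto simp: Proper defs g_def dist_norm norm_minus_commute)
    then show ?thesis
    proof cases
      case ell
      have s0: "s > 0" using ell(1) norm_ge_zero[of g] by linarith
      have "s\<^sup>2 - (norm g)\<^sup>2 > 0" using ell(1) by (simp add: power_strict_mono)
      moreover have "2 * s * norm y = \<bar>(s\<^sup>2 - (norm g)\<^sup>2) - ((-2) *\<^sub>R g) \<bullet> y\<bar>"
        if "a * norm y = \<bar>c - b \<bullet> y\<bar>" for y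
      proof -
        have "norm (y - g) = s - norm y" using pts[OF that] unfolding ell(2) by (simp add: dst)
        then have "(s - norm y)\<^sup>2 = (norm y)\<^sup>2 - 2 * (g \<bullet> y) + (norm g)\<^sup>2" using sq[of y] by simp
        then have "(s\<^sup>2 - (norm g)\<^sup>2) - ((-2) *\<^sub>R g) \<bullet> y = 2 * s * norm y"
          by (simp add: power2_eq_square algebra_simps)
        then show ?thesis using s0 by simp
      qed
      ultimately obtain \<kappa> where \<kappa>: "\<kappa> > 0" "2 * s = \<kappa> * a" "(-2) *\<^sub>R g = \<kappa> *\<^sub>R b"
        "s\<^sup>2 - (norm g)\<^sup>2 = \<kappa> * c"
        using focal_conic_coeffs_unique[OF ac, of "2 * s" "s\<^sup>2 - (norm g)\<^sup>2" b "(-2) *\<^sub>R g"] s0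
        by auto
      have "b = (1 / \<kappa>) *\<^sub>R (\<kappa> *\<^sub>R b)" using \<kappa>(1) by simp
      then have "b = - (2 / \<kappa>) *\<^sub>R g" unfolding \<kappa>(3)[symmetric] by simp
      then show ?thesis
        using \<kappa> s0 by (intro proper[of s "2 / \<kappa>"]) (simp_all add: field_simps)
    next
      case hyp
      \<comment> \<open>Squaring gives the relation of the ellipse with signs reversed, so that the
        constant is again positive, as the uniqueness of the coefficients requires.\<close>
      have "(norm g)\<^sup>2 - s\<^sup>2 > 0" using hyp by (simp add: power_strict_mono)
      moreover have "2 * s * norm y = \<bar>((norm g)\<^sup>2 - s\<^sup>2) - (2 *\<^sub>R g) \<bullet> y\<bar>"
        if "a * norm y = \<bar>c - b \<bullet> y\<bar>" for y
      proof -
        have "norm (y - g) = norm y - s \<or> norm (y - g) = norm y + s"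
          using pts[OF that] unfolding hyp(3) by (auto simp: dst abs_if split: if_splits)
        then have "(norm y - s)\<^sup>2 = (norm y)\<^sup>2 - 2 * (g \<bullet> y) + (norm g)\<^sup>2
            \<or> (norm y + s)\<^sup>2 = (norm y)\<^sup>2 - 2 * (g \<bullet> y) + (norm g)\<^sup>2" using sq[of y] by auto
        then have "((norm g)\<^sup>2 - s\<^sup>2) - (2 *\<^sub>R g) \<bullet> y = - (2 * s * norm y)
            \<or> ((norm g)\<^sup>2 - s\<^sup>2) - (2 *\<^sub>R g) \<bullet> y = 2 * s * norm y"
          by (auto simp: power2_eq_square algebra_simps)
        moreover have "2 * s * norm y \<ge> 0" using hyp(1) by simp
        ultimately show ?thesis by linarith
      qed
      ultimately obtain \<kappa> where \<kappa>: "\<kappa> > 0" "2 * s = \<kappa> * a" "2 *\<^sub>R g = \<kappa> *\<^sub>R b"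
        "(norm g)\<^sup>2 - s\<^sup>2 = \<kappa> * c"
        using focal_conic_coeffs_unique[OF ac, of "2 * s" "(norm g)\<^sup>2 - s\<^sup>2" b "2 *\<^sub>R g"] hyp(1)
        by auto
      have "b = (1 / \<kappa>) *\<^sub>R (\<kappa> *\<^sub>R b)" using \<kappa>(1) by simp
      then have "b = - (- 2 / \<kappa>) *\<^sub>R g" unfolding \<kappa>(3)[symmetric] by simp
      then show ?thesis
        using \<kappa> hyp(1) by (intro proper[of "- s" "- 2 / \<kappa>"]) (simp_all add: field_simps)
    qed
  next
    case (Ideal d)
    from F' obtain c' where d: "d \<noteq> 0" "c' \<noteq> 0"
      "conic_points K = {X. dist X F = infdist X {Y. d \<bullet> (Y - F) = c'}}"
      by (auto simp: Ideal defs)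
    \<comment> \<open>The factor \<open>sgn c'\<close> makes the constant of the directrix equation
      positive.\<close>
    have "norm d * norm y = \<bar>\<bar>c'\<bar> - (sgn c' *\<^sub>R d) \<bullet> y\<bar>"
      if "a * norm y = \<bar>c - b \<bullet> y\<bar>" for y
    proof -
      have "norm y = infdist (F + y) {Y. d \<bullet> (Y - F) = c'}"
        using pts[OF that] unfolding d(3) by (simp add: dist_norm)
      then have "norm d * norm y = \<bar>c' - d \<bullet> y\<bar>"
        using infdist_line[OF d(1), of "F + y" F c'] by simp
      then show ?thesis using d(2) by (auto simp: sgn_if abs_if)
    qed
    then obtain \<kappa> where \<kappa>: "\<kappa> > 0" "norm d = \<kappa> * a" "sgn c' *\<^sub>R d = \<kappa> *\<^sub>R b"
      "\<bar>c'\<bar> = \<kappa> * c"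
      using focal_conic_coeffs_unique[OF ac, of "norm d" "\<bar>c'\<bar>" b "sgn c' *\<^sub>R d"] d
      by auto
    define h where "h = - sgn c' *\<^sub>R d"
    have h: "norm h = norm d" using d by (simp add: h_def abs_sgn_eq)
    have Nm: "N m = (1 / \<kappa>) *\<^sub>R (norm d *\<^sub>R m - h)" for m
      using \<kappa>(1) by (simp add: h_def \<kappa>(2,3) N algebra_simps)
    have "line_to Z F' = affine hull {Z, Z + h}"
      unfolding Ideal line_to.simps h_def
      by (rule affine_hull_direction_scaleR[symmetric]) (use d in \<open>simp add: sgn_eq_0_iff\<close>)
    moreover have "h \<noteq> 0" using h d(1) by auto
    ultimately show ?thesis
      using main[of h "1 / \<kappa>" "norm d *\<^sub>R m\<^sub>1" "norm d *\<^sub>R m\<^sub>2"] h d m \<kappa>(1) Nm by auto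
  qed
qed

section \<open>Sides viewed both as tangents of \<open>CL\<close> and as chords of
  \<open>C\<close>\<close>

theorem theorem5:
  fixes C CL :: focal_conic and F Z :: complex and F' :: xpoint
    and V :: "nat \<Rightarrow> complex" and M :: "nat \<Rightarrow> xpoint" and n i j :: nat
  assumes "discrete_conic C n V"
    and "focus C = F"
    and "nondegenerate_conic CL"
    and "focus CL = F"
    and "other_focus CL F'"
    and "\<And>k. k \<in> {1..n} \<Longrightarrow> tangent_at CL (side V k) (M k)"
    and "i \<in> {1..n}"
    and "j \<in> {1..n}"
    and "side V i \<noteq> side V j"
    and "Z \<in> side V i \<inter> side V j"
  shows "bisects_angle CL Z (M i) (M j) \<and>
         bisects_angle C Z (Proper (V i)) (Proper (V (j + 1))) \<and>
         bisects_angle C Z (Proper (V (i + 1))) (Proper (V j)) \<and>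
         isogonal Z (line_to Z (Proper F)) (line_to Z F') (side V i) (side V j)"
proof -
  have c0: "coef_0 CL > 0" using assms(3) by (simp add: nondegenerate_conic_def)
  \<comment> \<open>The tangent equation has a positive constant, which the focus cannot
    attain.\<close>
  have nf: "focus C \<notin> side V k" if "k \<in> {1..n}" for k
    using tangent_at_line[OF assms(3) assms(6)[OF that]] c0 assms(2,4)
    by (metis (mono_tags, lifting) cancel_comm_monoid_add_class.diff_cancel inner_zero_right
        less_irrefl mem_Collect_eq)
  have ZF: "Z \<noteq> F" using nf[OF assms(7)] assms(2,10) by auto
  then have z: "Z - F \<noteq> 0" by simp
  have norm_ray: "norm u = 1" if "on_ray K u P" for K u P
    using that by (cases P) auto

  obtain m\<^sub>i where mi: "on_ray CL m\<^sub>i (M i)"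
    "side V i = {X. (coef_x CL + coef_r CL *\<^sub>R m\<^sub>i) \<bullet> (X - F) = coef_0 CL}"
    using tangent_at_line[OF assms(3) assms(6)[OF assms(7)]] assms(4) by metis
  obtain m\<^sub>j where mj: "on_ray CL m\<^sub>j (M j)"
    "side V j = {X. (coef_x CL + coef_r CL *\<^sub>R m\<^sub>j) \<bullet> (X - F) = coef_0 CL}"
    using tangent_at_line[OF assms(3) assms(6)[OF assms(8)]] assms(4) by metis
  have m: "m\<^sub>i \<noteq> m\<^sub>j" "norm m\<^sub>i = 1" "norm m\<^sub>j = 1"
    using mi mj assms(9) norm_ray by auto
  have Zm: "(coef_x CL + coef_r CL *\<^sub>R m\<^sub>i) \<bullet> (Z - F) = coef_0 CL"
    "(coef_x CL + coef_r CL *\<^sub>R m\<^sub>j) \<bullet> (Z - F) = coef_0 CL"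
    using assms(10) unfolding mi(2) mj(2) by simp_all
  have "coef_r CL * ((Z - F) \<bullet> m\<^sub>i) = coef_r CL * ((Z - F) \<bullet> m\<^sub>j)"
    using Zm unfolding inner_add_left inner_scaleR_left inner_commute[of "Z - F"] by linarith
  then have "(Z - F) \<bullet> m\<^sub>i = (Z - F) \<bullet> m\<^sub>j"
    using assms(3) by (simp add: nondegenerate_conic_def)
  then have "mirror 0 (Z - F) m\<^sub>i = m\<^sub>j"
    using mirror_swaps(2)[OF z] m by simp
  then have 1: "bisects_angle CL Z (M i) (M j)"
    using mi mj ZF assms(4) unfolding bisects_angle_def by blast

  obtain \<theta> w e where w:
    "\<And>k. k \<in> {1..n} \<Longrightarrow> on_ray C (cis (- \<theta>) * w k) (Proper (V k))"
    "\<And>k. k \<in> {1..n} \<Longrightarrow> on_ray C (cis \<theta> * w k) (Proper (V (k + 1)))"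
    "\<And>k. k \<in> {1..n} \<Longrightarrow>
      side V k = {X. (cos \<theta> *\<^sub>R coef_x C + coef_r C *\<^sub>R w k) \<bullet> (X - F) = e}"
    using discrete_conic_sides[OF assms(1) nf] assms(2) by metis
  \<comment> \<open>If \<open>w i = w j\<close>, or if \<open>coef_r C = 0\<close>, the two sides
    would have the same equation.\<close>
  have wij: "w i \<noteq> w j" "coef_r C \<noteq> 0"
    using w(3)[OF assms(7)] w(3)[OF assms(8)] assms(9) by auto
  have "norm (w k) = 1" if "k \<in> {1..n}" for k
    using norm_ray[OF w(1)[OF that]] by (simp add: norm_mult)
  then have nw: "norm (w i) = norm (w j)" using assms(7,8) by simp
  have "(cos \<theta> *\<^sub>R coef_x C + coef_r C *\<^sub>R w i) \<bullet> (Z - F) = e"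
    "(cos \<theta> *\<^sub>R coef_x C + coef_r C *\<^sub>R w j) \<bullet> (Z - F) = e"
    using assms(10) unfolding w(3)[OF assms(7)] w(3)[OF assms(8)] by simp_all
  then have "coef_r C * ((Z - F) \<bullet> w i) = coef_r C * ((Z - F) \<bullet> w j)"
    unfolding inner_add_left inner_scaleR_left inner_commute[of "Z - F"] by linarith
  then have "mirror 0 (Z - F) (w i) = w j"
    using mirror_swaps(2)[OF z nw wij(1)] wij(2) by simp
  \<comment> \<open>A reflection reverses rotations, so the start of side \<open>i\<close> is paired
    with the end of side \<open>j\<close>, and vice versa.\<close>
  then have mir: "mirror 0 (Z - F) (cis \<psi> * w i) = cis (- \<psi>) * w j" for \<psi>
    by (simp add: mirror_def cis_cnj mult.left_commute flip: times_divide_eq_right)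
  have 2: "bisects_angle C Z (Proper (V i)) (Proper (V (j + 1)))"
    using w(1)[OF assms(7)] w(2)[OF assms(8)] mir[of "- \<theta>"] ZF assms(2)
    unfolding bisects_angle_def by (metis minus_minus)
  have 3: "bisects_angle C Z (Proper (V (i + 1))) (Proper (V j))"
    using w(2)[OF assms(7)] w(1)[OF assms(8)] mir[of \<theta>] ZF assms(2)
    unfolding bisects_angle_def by metis
  have "isogonal Z (line_to Z (Proper F)) (line_to Z F') (side V i) (side V j)"
    using isogonal_tangents[OF assms(3,5) m(2,3,1)] Zm
    unfolding mi(2) mj(2) by (simp add: assms(4))
  then show ?thesis using 1 2 3 by blast
qed

end
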